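(* Let $X$ be a separable metric space, $s\in\mathbb S$ and let $\phi$ be a gauge. If $\phi\asymp s$, then $\mathcal D^{\mathsf H}_X(\overline s)=\mathcal N(\mathscr H^\phi)$.
   Context: $\mathbb S$ is the set of all strictly decreasing sequences $s=(s_n)_{n\geq1}$ of positive reals converging to $0$. For $s\in\mathbb S$ and $k\geq1$ let $s^{\times k}=(s_{kn})_{n\geq1}$, and let $\overline s=\{s^{\times k}:k\geq1\}$. For $S\subseteq\mathbb S$, a set $E\subseteq X$ is Hausdorff $S$-dominated if for each $t\in S$ and each $\varepsilon>0$ there are a set $I\subseteq\{1,2,3,\dots\}$ with $\sum_{n\in I}\frac1n<\varepsilon$ and a family $(E_n)_{n\in I}$ of subsets of $X$ that covers $E$ and satisfies $\operatorname{diam}E_n<t_n$ for all $n\in I$. $\mathcal D^{\mathsf H}_X(S)$ is the family of all Hausdorff $S$-dominated subsets of $X$. A gauge is a non-decreasing right-continuous function $\phi\colon[0,\infty)\to[0,\infty)$ with $\phi(0)=0$ and $\phi(r)>0$ for $r>0$. For a gauge $\phi$ and $s\in\mathbb S$, $\phi\asymp s$ means that there are $a,b>0$ such that $a\leq n\phi(s_n)\leq b$ for all but finitely many $n$. The Hausdorff measure on $X$ is $\mathscr H^\phi(E)=\sup_{\delta>0}\inf\{\sum_n\phi(\operatorname{diam}E_n):\{E_n\}\text{ a countable cover of }E\text{ by subsets of }X\text{ with }\operatorname{diam}E_n<\delta\text{ for all }n\}$, and $\mathcal N(\mathscr H^\phi)=\{E\subseteq X:\mathscr H^\phi(E)=0\}$.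 *)

theory Defs
  imports "HOL-Analysis.Analysis"
begin

text \<open>Sequences are indexed from 1, as functions on \<^typ>\<open>nat\<close> whose value at 0 is irrelevant.\<close>

definition decreasing_null_seqs :: "(nat \<Rightarrow> real) set" where
  "decreasing_null_seqs =
     {s. (\<forall>n\<ge>1. 0 < s n) \<and> strict_antimono_on {1..} s \<and> s \<longlonglongrightarrow> 0}"

definition seq_dilate :: "(nat \<Rightarrow> real) \<Rightarrow> nat \<Rightarrow> nat \<Rightarrow> real" where
  "seq_dilate s k = (\<lambda>n. s (k * n))"

definition seq_dilates :: "(nat \<Rightarrow> real) \<Rightarrow> (nat \<Rightarrow> real) set" where
  "seq_dilates s = {seq_dilate s k | k. 1 \<le> k}"

text \<open>The diameter is extended-valued, so unbounded sets have diameter \<open>\<infinity>\<close>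
  (the library's \<^const>\<open>diameter\<close> is real-valued and unspecified on them); the empty set
  has diameter 0.\<close>

definition ediam :: "'a metric \<Rightarrow> 'a set \<Rightarrow> ennreal" where
  "ediam X A = (SUP x\<in>A. SUP y\<in>A. ennreal (mdist X x y))"

text \<open>The sum over the possibly infinite index set \<open>I\<close> is taken in \<^typ>\<open>ennreal\<close>,
  where it always exists, so its being \<open>< \<epsilon>\<close> includes convergence.\<close>

definition hausdorff_dominated :: "'a metric \<Rightarrow> (nat \<Rightarrow> real) set \<Rightarrow> 'a set \<Rightarrow> bool" where
  "hausdorff_dominated X S A \<longleftrightarrow>
     (\<forall>t\<in>S. \<forall>\<epsilon>::real. 0 < \<epsilon> \<longrightarrow>
        (\<exists>(I :: nat set) (E :: nat \<Rightarrow> 'a set).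
           I \<subseteq> {1..} \<and>
           (\<Sum>\<^sub>\<infinity>n\<in>I. ennreal (1 / real n)) < ennreal \<epsilon> \<and>
           (\<forall>n\<in>I. E n \<subseteq> mspace X) \<and>
           A \<subseteq> (\<Union>n\<in>I. E n) \<and>
           (\<forall>n\<in>I. ediam X (E n) < ennreal (t n))))"

definition hausdorff_dominated_sets :: "'a metric \<Rightarrow> (nat \<Rightarrow> real) set \<Rightarrow> 'a set set" where
  "hausdorff_dominated_sets X S = {A. A \<subseteq> mspace X \<and> hausdorff_dominated X S A}"

text \<open>Only the values of a gauge on \<open>[0, \<infinity>)\<close> matter.  Nonnegativity there follows from
  the value at 0 and positivity elsewhere.\<close>

definition gauge_function :: "(real \<Rightarrow> real) \<Rightarrow> bool" where
  "gauge_function \<phi> \<longleftrightarrow>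
     mono_on {0..} \<phi> \<and>
     (\<forall>r\<ge>0. continuous (at_right r) \<phi>) \<and>
     \<phi> 0 = 0 \<and>
     (\<forall>r>0. 0 < \<phi> r)"

definition gauge_comparable :: "(real \<Rightarrow> real) \<Rightarrow> (nat \<Rightarrow> real) \<Rightarrow> bool" where
  "gauge_comparable \<phi> s \<longleftrightarrow>
     (\<exists>a b. 0 < a \<and> 0 < b \<and>
        (\<forall>\<^sub>F n in sequentially. a \<le> real n * \<phi> (s n) \<and> real n * \<phi> (s n) \<le> b))"

text \<open>Covers are sequences of sets.  Finite covers are included by padding with the empty set,
  which contributes \<open>\<phi> 0 = 0\<close>.  All sets have diameter below the real number \<open>\<delta>\<close>, so
  \<^const>\<open>enn2real\<close> is only applied to finite values.  If there is no cover, the infimum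
  is \<open>\<infinity>\<close>.\<close>

definition hausdorff_measure :: "'a metric \<Rightarrow> (real \<Rightarrow> real) \<Rightarrow> 'a set \<Rightarrow> ennreal" where
  "hausdorff_measure X \<phi> A =
     (SUP \<delta>\<in>{0 :: real<..}.
        INF E\<in>{E :: nat \<Rightarrow> 'a set.
                 (\<forall>n. E n \<subseteq> mspace X) \<and> A \<subseteq> (\<Union>n. E n) \<and>
                 (\<forall>n. ediam X (E n) < ennreal \<delta>)}.
          \<Sum>n. ennreal (\<phi> (enn2real (ediam X (E n)))))"

definition hausdorff_null_sets :: "'a metric \<Rightarrow> (real \<Rightarrow> real) \<Rightarrow> 'a set set" where
  "hausdorff_null_sets X \<phi> = {A. A \<subseteq> mspace X \<and> hausdorff_measure X \<phi> A = 0}"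

end

theory Submission
  imports Defs
begin

text \<open>
  Write \<open>d\<^sub>n\<close> for the diameter of the \<open>n\<close>-th set of a cover.  Comparability says that
  \<open>\<phi> (s n)\<close> is \<open>1 / n\<close> up to constants, so a set of diameter below \<open>s n\<close> costs at most a multiple
  of \<open>1 / n\<close>.  Hence a cover as in the definition of domination by \<open>s\<close> has \<open>\<phi>\<close>-cost at most a
  multiple of \<open>\<Sum>n\<in>I. 1 / n\<close>; as this sum is small, only large indices occur, which makes all the
  diameters small as well.

  In the other direction a set of cost \<open>\<phi> d\<close> fits below \<open>s (k * n)\<close> for every large \<open>n\<close> up to a
  multiple of \<open>1 / \<phi> d\<close>.  The sets of a cover must however receive different indices, while many of
  them may have the same diameter.  Two devices resolve this.  The costs are raised by a
  geometric series of small total, so that they are all positive and sets of diameter zero are no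
  exception.  Then a dyadic allocation (lemma \<open>injective_reciprocal_allocation\<close>)
  turns a series of costs \<open>y m > 0\<close> with total at most \<open>1 / 4\<close> into distinct indices \<open>n m\<close> with
  \<open>n m \<le> 1 / y m\<close> and \<open>1 / n m \<le> 4 * y m\<close>: the terms with \<open>y m\<close> in a given dyadic range are so few
  that they fit into a dyadic block of indices of the right size.
\<close>

section \<open>Sums of extended nonnegative reals\<close>

lemma sums_infsum_ennreal:
  fixes f :: "nat \<Rightarrow> ennreal"
  shows "(\<lambda>n. if n \<in> I then f n else 0) sums (\<Sum>\<^sub>\<infinity>n\<in>I. f n)"
proof -
  have "(\<Sum>\<^sub>\<infinity>n\<in>I. f n) = (\<Sum>\<^sub>\<infinity>n. if n \<in> I then f n else 0)"
    by (rule infsum_cong_neutral) auto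
  moreover have "((\<lambda>n. if n \<in> I then f n else 0) has_sum (\<Sum>\<^sub>\<infinity>n. if n \<in> I then f n else 0)) UNIV"
    by (rule has_sum_infsum) (simp add: nonneg_summable_on_complete)
  ultimately show ?thesis
    using has_sum_imp_sums by metis
qed

lemma infsum_range_ennreal:
  fixes f :: "nat \<Rightarrow> ennreal" and g :: "nat \<Rightarrow> nat"
  assumes "inj g"
  shows "(\<Sum>\<^sub>\<infinity>n\<in>range g. f n) = (\<Sum>m. f (g m))"
proof -
  have "(\<Sum>\<^sub>\<infinity>n\<in>range g. f n) = (\<Sum>\<^sub>\<infinity>m. f (g m))"
    using infsum_reindex[OF assms, of f] by (simp add: o_def)
  also have "\<dots> = (\<Sum>m. f (g m))"
    using sums_unique[OF sums_infsum_ennreal[where f="\<lambda>m. f (g m)" and I=UNIV]] by simp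
  finally show ?thesis .
qed

section \<open>Dyadic allocation of distinct indices\<close>

text \<open>
  Let \<open>m\<close> have level \<open>k\<close> when \<open>1 / 4 < y m * 2 ^ k \<le> 1 / 2\<close>.  Each index of level \<open>k\<close> uses up more
  than \<open>1 / (4 * 2 ^ k)\<close> of the total \<open>1 / 4\<close>, so there are at most \<open>2 ^ k\<close> of them.
  They are numbered consecutively from \<open>2 ^ k\<close> on and never reach \<open>2 ^ (k + 1)\<close>,
  where the block of the next level begins.
\<close>
lemma injective_reciprocal_allocation:
  fixes y :: "nat \<Rightarrow> real"
  assumes pos: "\<And>m. 0 < y m" and summable: "summable y" and small: "suminf y \<le> 1 / 4"
  obtains n :: "nat \<Rightarrow> nat" where
    "inj n" "\<And>m. 1 \<le> n m" "\<And>m. real (n m) * y m \<le> 1" "\<And>m. 1 / real (n m) \<le> 4 * y m"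
proof -
  have "\<exists>k. 2 * y m * 2 ^ k \<le> 1 \<and> 1 < 4 * y m * 2 ^ k" for m
  proof -
    obtain j where j: "1 / (2 * y m) < 2 ^ j"
      using real_arch_pow[of 2] by auto
    have "y m \<le> 1 / 4"
      using sum_le_suminf[OF summable, of "{m}"] pos small by (auto simp: less_imp_le intro: order_trans)
    then have "\<not> 1 / (2 * y m) < 2 ^ 0"
      using pos[of m] by (simp add: field_simps)
    with j obtain k where "\<forall>i\<le>k. \<not> 1 / (2 * y m) < 2 ^ i" "1 / (2 * y m) < 2 ^ Suc k"
      using ex_least_nat_less[of "\<lambda>i. 1 / (2 * y m) < 2 ^ i" j] by blast
    then have "2 ^ k \<le> 1 / (2 * y m)" "1 / (2 * y m) < 2 ^ Suc k"
      by auto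
    then show ?thesis
      using pos[of m] by (intro exI[of _ k]) (simp add: field_simps)
  qed
  then obtain level where
    level_le: "\<And>m. 2 * y m * 2 ^ level m \<le> 1" and level_gt: "\<And>m. 1 < 4 * y m * 2 ^ level m"
    by metis
  define rank where "rank m = card {i. i < m \<and> level i = level m}" for m
  define n where "n m = 2 ^ level m + rank m" for m
  have rank_less: "rank m < 2 ^ level m" for m
  proof -
    let ?F = "{i. i \<le> m \<and> level i = level m}"
    have "?F = insert m {i. i < m \<and> level i = level m}"
      by auto
    then have card: "card ?F = Suc (rank m)"
      by (simp add: rank_def)
    have "real (card ?F) * (1 / (4 * 2 ^ level m)) \<le> sum y ?F"
    proof (rule sum_bounded_below)
      show "1 / (4 * 2 ^ level m) \<le> y i" if "i \<in> ?F" for i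
        using that level_gt[of i] by (simp add: field_simps)
    qed
    also have "sum y ?F \<le> suminf y"
      by (rule sum_le_suminf[OF summable]) (auto simp: pos less_imp_le)
    also note small
    finally have "real (Suc (rank m)) \<le> 2 ^ level m"
      by (simp add: card field_simps)
    then have "Suc (rank m) \<le> 2 ^ level m"
      unfolding of_nat_le_iff of_nat_numeral[symmetric, where ?'a=real] of_nat_power[symmetric] .
    then show ?thesis
      by simp
  qed
  have n_less: "n m < 2 ^ Suc (level m)" and n_ge: "2 ^ level m \<le> n m" for m
    using rank_less[of m] by (auto simp: n_def)
  have rank_mono: "rank i < rank m" if "i < m" "level i = level m" for i m
    unfolding rank_def by (rule psubset_card_mono) (use that in auto)
  have inj: "inj n"
  proof (rule linorder_injI)
    fix i m :: nat assume "i < m"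
    have "n p < n q" if "level p < level q" for p q
    proof -
      have "(2::nat) ^ Suc (level p) \<le> 2 ^ level q"
        using that by (intro power_increasing) auto
      then show ?thesis
        using n_less[of p] n_ge[of q] by linarith
    qed
    then show "n i \<noteq> n m"
      using rank_mono[OF \<open>i < m\<close>]
      by (cases "level i" "level m" rule: linorder_cases) (metis less_irrefl, simp add: n_def, metis less_irrefl)
  qed
  have n_bounds: "2 ^ level m \<le> real (n m)" "real (n m) \<le> 2 * 2 ^ level m" for m
    using n_ge[of m] n_less[of m] rank_less[of m] by (auto simp: n_def simp flip: of_nat_less_iff)
  show thesis
  proof (rule that[OF inj])
    fix m
    show "1 \<le> n m"
      using n_ge[of m] by (meson one_le_numeral one_le_power order_trans)
    have "real (n m) * y m \<le> 2 * 2 ^ level m * y m"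
      using n_bounds(2) pos[of m] by (intro mult_right_mono) auto
    also have "\<dots> \<le> 1"
      using level_le[of m] by (simp add: mult_ac)
    finally show "real (n m) * y m \<le> 1" .
    have "1 / real (n m) \<le> 1 / 2 ^ level m"
      by (rule divide_left_mono[OF n_bounds(1)]) (auto simp: n_def intro!: mult_pos_pos add_pos_nonneg)
    also have "\<dots> \<le> 4 * y m"
      using level_gt[of m] by (simp add: field_simps)
    finally show "1 / real (n m) \<le> 4 * y m" .
  qed
qed

section \<open>Diameters and gauges\<close>

lemma ediam_empty [simp]: "ediam X {} = 0"
  by (simp add: ediam_def bot_ennreal)

lemma ediam_eq_ennreal:
  assumes "ediam X A < ennreal r"
  shows "ediam X A = ennreal (enn2real (ediam X A))"
  using assms by (simp add: ennreal_enn2real less_trans[OF _ ennreal_less_top])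

lemma gauge_function_nonneg:
  assumes "gauge_function \<phi>" "0 \<le> r"
  shows "0 \<le> \<phi> r"
  using assms by (cases "r = 0") (auto simp: gauge_function_def less_imp_le)

lemma gauge_function_mono:
  assumes "gauge_function \<phi>" "0 \<le> r" "r \<le> r'"
  shows "\<phi> r \<le> \<phi> r'"
  using assms by (auto simp: gauge_function_def intro: mono_onD)

section \<open>Dominated sets and null sets\<close>

text \<open>
  The sum bound forces every index of the cover beyond any prescribed threshold, because a single
  term already has \<open>1 / n < \<epsilon>\<close>.  Beyond the threshold \<open>\<phi> (s n) \<le> b / n\<close> and \<open>s n \<le> \<delta>\<close>,
  so that the cover competes in the infimum for \<open>\<delta>\<close> at a cost of at most \<open>b * \<epsilon>\<close>.
\<close>
lemma hausdorff_measure_eq_0_if_dominated: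
  assumes s: "s \<in> decreasing_null_seqs" and gauge: "gauge_function \<phi>"
    and comparable: "gauge_comparable \<phi> s"
    and dominated: "hausdorff_dominated X S A" and "s \<in> S"
  shows "hausdorff_measure X \<phi> A = 0"
proof -
  obtain b where "0 < b" and ev_le: "\<forall>\<^sub>F n in sequentially. real n * \<phi> (s n) \<le> b"
    using comparable unfolding gauge_comparable_def eventually_conj_iff by blast
  have inf_0: "(INF E\<in>{E. (\<forall>n. E n \<subseteq> mspace X) \<and> A \<subseteq> (\<Union>n. E n) \<and> (\<forall>n. ediam X (E n) < ennreal \<delta>)}.
          \<Sum>n. ennreal (\<phi> (enn2real (ediam X (E n))))) = 0" (is "?H = 0") if "0 < \<delta>" for \<delta> :: real
  proof -
    have "s \<longlonglongrightarrow> 0"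
      using s by (simp add: decreasing_null_seqs_def)
    then have "\<forall>\<^sub>F n in sequentially. s n < \<delta>"
      using \<open>0 < \<delta>\<close> by (rule order_tendstoD)
    with ev_le have "\<forall>\<^sub>F n in sequentially. real n * \<phi> (s n) \<le> b \<and> s n < \<delta>"
      by (rule eventually_conj)
    then obtain N where N: "\<And>n. N \<le> n \<Longrightarrow> real n * \<phi> (s n) \<le> b \<and> s n < \<delta>"
      unfolding eventually_sequentially by blast
    have le_e: "?H \<le> ennreal e" if "0 < e" for e
    proof -
      define \<epsilon> where "\<epsilon> = min (e / b) (1 / real (Suc N))"
      have "0 < \<epsilon>"
        using \<open>0 < e\<close> \<open>0 < b\<close> by (simp add: \<epsilon>_def)
      then obtain I E where I: "I \<subseteq> {1..}" "(\<Sum>\<^sub>\<infinity>n\<in>I. ennreal (1 / real n)) < ennreal \<epsilon>"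
        and E: "\<And>n. n \<in> I \<Longrightarrow> E n \<subseteq> mspace X" "A \<subseteq> (\<Union>n\<in>I. E n)"
          "\<And>n. n \<in> I \<Longrightarrow> ediam X (E n) < ennreal (s n)"
        using dominated \<open>s \<in> S\<close> unfolding hausdorff_dominated_def by metis
      note I_sums = sums_infsum_ennreal[of I "\<lambda>n. ennreal (1 / real n)"]
      have large: "N \<le> n" if "n \<in> I" for n
      proof -
        have "ennreal (1 / real n) \<le> (\<Sum>\<^sub>\<infinity>n\<in>I. ennreal (1 / real n))"
          using sum_le_suminf[of "\<lambda>n. if n \<in> I then ennreal (1 / real n) else 0" "{n}"]
            sums_unique[OF I_sums] that by simp
        also note I(2)
        finally have "1 / real n < \<epsilon>"
          using \<open>0 < \<epsilon>\<close> by (simp add: ennreal_less_iff)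
        also have "\<epsilon> \<le> 1 / real (Suc N)"
          by (simp add: \<epsilon>_def)
        finally have "real (Suc N) < real n"
          using that I(1) by (auto simp: field_simps)
        then show ?thesis
          by simp
      qed
      define F where "F n = (if n \<in> I then E n else {})" for n
      have cost: "ennreal (\<phi> (enn2real (ediam X (F n))))
          \<le> ennreal b * (if n \<in> I then ennreal (1 / real n) else 0)" for n
      proof (cases "n \<in> I")
        case True
        then have "1 \<le> n" "0 < s n"
          using I(1) s by (auto simp: decreasing_null_seqs_def)
        have "enn2real (ediam X (E n)) \<le> s n"
          by (intro enn2real_leI less_imp_le[OF E(3)[OF True]] less_imp_le[OF \<open>0 < s n\<close>])
        then have "\<phi> (enn2real (ediam X (E n))) \<le> \<phi> (s n)"
          by (intro gauge_function_mono[OF gauge]) auto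
        also have "\<phi> (s n) \<le> b * (1 / real n)"
          using N[OF large[OF True]] \<open>1 \<le> n\<close> by (simp add: field_simps)
        finally have "ennreal (\<phi> (enn2real (ediam X (E n)))) \<le> ennreal (b * (1 / real n))"
          by (rule ennreal_leI)
        then show ?thesis
          using True \<open>0 < b\<close> by (simp add: F_def ennreal_mult'[symmetric])
      next
        case False
        then show ?thesis
          using gauge by (simp add: F_def gauge_function_def)
      qed
      have "?H \<le> (\<Sum>n. ennreal (\<phi> (enn2real (ediam X (F n)))))"
      proof (intro INF_lower CollectI conjI allI)
        show "F n \<subseteq> mspace X" for n
          using E(1) by (simp add: F_def)
        show "A \<subseteq> (\<Union>n. F n)"
        proof
          fix x assume "x \<in> A"
          then obtain n where "n \<in> I" "x \<in> E n"
            using E(2) by blast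
          then show "x \<in> (\<Union>n. F n)"
            by (intro UN_I[of n]) (auto simp: F_def)
        qed
        show "ediam X (F n) < ennreal \<delta>" for n
        proof (cases "n \<in> I")
          case True
          have "ediam X (E n) < ennreal (s n)"
            by (rule E(3)[OF True])
          also have "\<dots> \<le> ennreal \<delta>"
            using N[OF large[OF True]] by (intro ennreal_leI) simp
          finally show ?thesis
            using True by (simp add: F_def)
        next
          case False
          then show ?thesis
            using \<open>0 < \<delta>\<close> by (simp add: F_def)
        qed
      qed
      also have "\<dots> \<le> (\<Sum>n. ennreal b * (if n \<in> I then ennreal (1 / real n) else 0))"
        by (intro suminf_le cost) auto
      also have "\<dots> = ennreal b * (\<Sum>\<^sub>\<infinity>n\<in>I. ennreal (1 / real n))"
        using sums_unique[OF I_sums] by (simp add: ennreal_suminf_cmult)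
      also have "\<dots> \<le> ennreal b * ennreal \<epsilon>"
        using I(2) by (intro mult_left_mono) auto
      also have "\<dots> = ennreal (b * \<epsilon>)"
        using \<open>0 < b\<close> by (simp add: ennreal_mult')
      also have "\<dots> \<le> ennreal e"
      proof (rule ennreal_leI)
        have "b * \<epsilon> \<le> b * (e / b)"
          using \<open>0 < b\<close> by (intro mult_left_mono) (auto simp: \<epsilon>_def)
        then show "b * \<epsilon> \<le> e"
          using \<open>0 < b\<close> by simp
      qed
      finally show ?thesis .
    qed
    have "?H \<le> 0"
      by (rule ennreal_le_epsilon, subst add_0_left, rule le_e)
    then show ?thesis
      by simp
  qed
  have "hausdorff_measure X \<phi> A \<le> 0"
    unfolding hausdorff_measure_def by (rule SUP_least) (simp only: inf_0 greaterThan_iff order_refl)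
  then show ?thesis
    by simp
qed

text \<open>
  A cover of small cost is re-indexed.  With \<open>x m\<close> slightly above \<open>\<phi> (d m)\<close>, the allocation for
  \<open>y m = k * x m / a\<close> yields an index \<open>n\<close> with \<open>\<phi> (d m) < x m \<le> a / (k * n) \<le> \<phi> (s (k * n))\<close>,
  and monotonicity of \<open>\<phi>\<close> turns this into \<open>d m < s (k * n)\<close>.
\<close>
lemma dominated_if_hausdorff_measure_eq_0:
  assumes s: "s \<in> decreasing_null_seqs" and gauge: "gauge_function \<phi>"
    and comparable: "gauge_comparable \<phi> s"
    and null: "hausdorff_measure X \<phi> A = 0"
  shows "hausdorff_dominated X (seq_dilates s) A"
  unfolding hausdorff_dominated_def
proof (intro ballI allI impI)
  fix t and \<epsilon> :: real
  assume "t \<in> seq_dilates s" and "0 < \<epsilon>"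
  then obtain k where "1 \<le> k" and t: "t = (\<lambda>n. s (k * n))"
    by (auto simp: seq_dilates_def seq_dilate_def)
  obtain a where "0 < a" and "\<forall>\<^sub>F n in sequentially. a \<le> real n * \<phi> (s n)"
    using comparable unfolding gauge_comparable_def eventually_conj_iff by blast
  then obtain N where N: "\<And>n. N \<le> n \<Longrightarrow> a \<le> real n * \<phi> (s n)"
    unfolding eventually_sequentially by blast
  \<comment> \<open>The three bounds make the allocation possible, its reciprocal sum smaller than \<open>\<epsilon>\<close>, and every
    allocated index at least \<open>N\<close>.\<close>
  define \<eta> where "\<eta> = min (1 / 4) (min (\<epsilon> / 8) (1 / (4 * real (Suc N))))"
  have "0 < \<eta>"
    using \<open>0 < \<epsilon>\<close> by (simp add: \<eta>_def)
  \<comment> \<open>Half of the budget goes to the cost of the cover, half to the geometric series.\<close>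
  define \<theta> where "\<theta> = a * \<eta> / (2 * real k)"
  have "0 < \<theta>"
    using \<open>0 < a\<close> \<open>0 < \<eta>\<close> \<open>1 \<le> k\<close> by (simp add: \<theta>_def)
  have "(INF E\<in>{E. (\<forall>n. E n \<subseteq> mspace X) \<and> A \<subseteq> (\<Union>n. E n) \<and> (\<forall>n. ediam X (E n) < ennreal 1)}.
          \<Sum>n. ennreal (\<phi> (enn2real (ediam X (E n))))) \<le> hausdorff_measure X \<phi> A"
    unfolding hausdorff_measure_def by (rule SUP_upper2[of 1]) auto
  also have "\<dots> < ennreal \<theta>"
    using null \<open>0 < \<theta>\<close> by simp
  finally obtain E where E: "\<And>m. E m \<subseteq> mspace X" "A \<subseteq> (\<Union>m. E m)"
      "\<And>m. ediam X (E m) < ennreal 1"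
    and E_cost: "(\<Sum>m. ennreal (\<phi> (enn2real (ediam X (E m))))) < ennreal \<theta>"
    unfolding INF_less_iff by auto
  define d where "d m = enn2real (ediam X (E m))" for m
  have d: "0 \<le> d m" "ediam X (E m) = ennreal (d m)" for m
    using ediam_eq_ennreal[OF E(3)] by (auto simp: d_def)
  have \<phi>_nonneg: "0 \<le> \<phi> (d m)" for m
    using gauge d(1) by (rule gauge_function_nonneg)
  have \<phi>_summable: "summable (\<lambda>m. \<phi> (d m))"
    using \<phi>_nonneg E_cost by (intro summable_suminf_not_top) (auto simp: d_def top_unique)
  have "ennreal (\<Sum>m. \<phi> (d m)) < ennreal \<theta>"
    using E_cost suminf_ennreal2[OF \<phi>_nonneg \<phi>_summable] by (simp add: d_def)
  then have \<phi>_sum: "(\<Sum>m. \<phi> (d m)) \<le> \<theta>"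
    using \<open>0 < \<theta>\<close> by (auto simp: ennreal_less_iff suminf_nonneg \<phi>_nonneg \<phi>_summable)
  define x where "x m = \<phi> (d m) + \<theta> * (1 / 2) ^ Suc m" for m
  have x_sums: "x sums ((\<Sum>m. \<phi> (d m)) + \<theta> * 1)"
    unfolding x_def by (intro sums_add summable_sums \<phi>_summable sums_mult power_half_series)
  define y where "y m = real k / a * x m" for m
  have y_sums: "y sums (real k / a * ((\<Sum>m. \<phi> (d m)) + \<theta> * 1))"
    unfolding y_def by (rule sums_mult[OF x_sums])
  have "suminf y \<le> real k / a * (\<theta> + \<theta>)"
    unfolding sums_unique[OF y_sums, symmetric]
    by (rule mult_left_mono) (use \<phi>_sum \<open>0 < a\<close> in auto)
  also have "\<dots> = \<eta>"
    using \<open>0 < a\<close> \<open>1 \<le> k\<close> by (simp add: \<theta>_def field_simps)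
  finally have y_sum: "suminf y \<le> \<eta>" .
  have x_gt: "\<phi> (d m) < x m" for m
    using \<open>0 < \<theta>\<close> by (simp add: x_def)
  then have "0 < x m" for m
    using \<phi>_nonneg le_less_trans by blast
  then have y_pos: "0 < y m" for m
    using \<open>0 < a\<close> \<open>1 \<le> k\<close> by (simp add: y_def)
  obtain n where n: "inj n" "\<And>m. 1 \<le> n m" "\<And>m. real (n m) * y m \<le> 1" "\<And>m. 1 / real (n m) \<le> 4 * y m"
    using injective_reciprocal_allocation[OF y_pos sums_summable[OF y_sums]] y_sum
    by (auto simp: \<eta>_def)
  have n_large: "N \<le> n m" for m
  proof -
    have "y m \<le> \<eta>"
      using sum_le_suminf[OF sums_summable[OF y_sums], of "{m}"] y_pos y_sum
      by (auto simp: less_imp_le intro: order_trans)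
    then have "1 / real (n m) \<le> 4 * \<eta>"
      using n(4)[of m] by linarith
    also have "\<dots> \<le> 4 * (1 / (4 * real (Suc N)))"
      by (rule mult_left_mono) (auto simp: \<eta>_def)
    also have "\<dots> = 1 / real (Suc N)"
      by (simp add: field_simps)
    finally have "real (Suc N) \<le> real (n m)"
      using n(2)[of m] by (simp add: field_simps)
    then show ?thesis
      by simp
  qed
  have d_less: "d m < s (k * n m)" for m
  proof (rule ccontr)
    assume "\<not> d m < s (k * n m)"
    have "1 * n m \<le> k * n m"
      using \<open>1 \<le> k\<close> by (rule mult_right_mono) simp
    then have kn: "1 \<le> k * n m" "N \<le> k * n m"
      using n(2)[of m] n_large[of m] by linarith+
    then have "0 < s (k * n m)"
      using s by (simp add: decreasing_null_seqs_def)
    then have "\<phi> (s (k * n m)) \<le> \<phi> (d m)"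
      using \<open>\<not> d m < s (k * n m)\<close> by (intro gauge_function_mono[OF gauge]) auto
    also note x_gt
    finally have "real (k * n m) * \<phi> (s (k * n m)) < real (k * n m) * x m"
      using kn(1) by (intro mult_strict_left_mono) auto
    moreover have "real (k * n m) * x m \<le> a"
      using n(3)[of m] \<open>0 < a\<close> by (simp add: y_def field_simps)
    ultimately show False
      using N[OF kn(2)] by linarith
  qed
  have "(\<Sum>\<^sub>\<infinity>j\<in>range n. ennreal (1 / real j)) = (\<Sum>m. ennreal (1 / real (n m)))"
    by (rule infsum_range_ennreal[OF n(1)])
  also have "\<dots> \<le> (\<Sum>m. ennreal (4 * y m))"
    by (intro suminf_le ennreal_leI n(4)) auto
  also have "\<dots> = ennreal (4 * suminf y)"
    using y_pos sums_summable[OF y_sums]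
    by (subst suminf_ennreal2) (auto simp: suminf_mult less_imp_le)
  also have "\<dots> < ennreal \<epsilon>"
    using y_sum \<open>0 < \<epsilon>\<close> by (intro ennreal_lessI) (auto simp: \<eta>_def)
  finally have sum_less: "(\<Sum>\<^sub>\<infinity>j\<in>range n. ennreal (1 / real j)) < ennreal \<epsilon>" .
  show "\<exists>I E. I \<subseteq> {1..} \<and> (\<Sum>\<^sub>\<infinity>n\<in>I. ennreal (1 / real n)) < ennreal \<epsilon> \<and>
          (\<forall>n\<in>I. E n \<subseteq> mspace X) \<and> A \<subseteq> (\<Union>n\<in>I. E n) \<and> (\<forall>n\<in>I. ediam X (E n) < ennreal (t n))"
  proof (intro exI[of _ "range n"] exI[of _ "\<lambda>j. E (inv n j)"] conjI)
    show "range n \<subseteq> {1..}"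
      using n(2) by auto
    show "\<forall>j\<in>range n. ediam X (E (inv n j)) < ennreal (t j)"
      using d_less d by (auto simp: inv_f_f[OF n(1)] t ennreal_less_iff)
  qed (use sum_less E(1,2) in \<open>simp_all add: inv_f_f[OF n(1)]\<close>)
qed

theorem theorem5p6:
  fixes X :: "'a metric" and s :: "nat \<Rightarrow> real" and \<phi> :: "real \<Rightarrow> real"
  assumes "separable_space (mtopology_of X)"
    and "s \<in> decreasing_null_seqs"
    and "gauge_function \<phi>"
    and "gauge_comparable \<phi> s"
  shows "hausdorff_dominated_sets X (seq_dilates s) = hausdorff_null_sets X \<phi>"
proof -
  have "seq_dilate s 1 = s"
    by (simp add: seq_dilate_def)
  then have "s \<in> seq_dilates s"
    unfolding seq_dilates_def by (metis (mono_tags, lifting) CollectI order_refl)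
  with assms(2-4) have "hausdorff_dominated X (seq_dilates s) A \<longleftrightarrow> hausdorff_measure X \<phi> A = 0" for A
    using hausdorff_measure_eq_0_if_dominated dominated_if_hausdorff_measure_eq_0 by blast
  then show ?thesis
    by (simp add: hausdorff_dominated_sets_def hausdorff_null_sets_def)
qed

end
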